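(* Let $\mathcal{T}$ be a mesh of $\Omega\subset\mathbb{R}^d$ with vertex set $S$ and let $\mathcal{D}$ be a sizing function with discrepancies $\zeta_K$, all as described in the context. Let $v$ be a function on $\Omega$ that is piecewise $H^1$ with respect to $\mathcal{T}$ and whose gradient on each $K\in\mathcal{T}$ is continuous on the closed simplex $K$. Let $(\nabla v)_h$ be the piecewise polynomial interpolation of $\nabla v$ of degree $\le k$, let $(\nabla v)^{\ast}$ be a piecewise polynomial best approximation of $\nabla v$ of degree $\le k$ over $\mathcal{T}$, and let $\Lambda$ be the Lebesgue constant of the interpolation points. Then $$\Psi_{\mathcal{T}}\big(\nabla v-(\nabla v)_h\big)\;\le\;(1+\Lambda)\,C_3\,\sqrt{\Theta}\;\big\|\nabla v-(\nabla v)^{\ast}\big\|_{L_\infty(\Omega)},$$ where $$C_3=\sqrt{\min\left[\frac12\max_{K}\left(R_{K,\min}\right)^2\left\|\frac{1}{\mathcal{D}^2}\right\|_{2,L_\infty(\Omega)}+\left\|\frac{1}{\mathcal{D}^2}\right\|_{L_\infty(\Omega)}+\max_K|\zeta_K|,\ \frac{1}{\eta^2}\right]},\qquad \Theta=\sum_{K\in\mathcal{T}}\left(\sum_{i=1}^{d+1}\sum_{j=1}^{i-1}(\bm{p}_{K,ij}\cdot\bm{p}_{K,ij})\,|K|\right).$$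
   Context: Points and mesh. $d\ge 1$ is an integer. $S=\{\bm{p}_1,\dots,\bm{p}_{N_v}\}\subset\mathbb{R}^d$ is a finite point set and $\Omega=\mathrm{conv}(S)$ (a bounded $d$-dimensional polytope). $S$ is an $(\varepsilon,\overline{\eta})$-net with $\varepsilon,\eta>0$, $\overline{\eta}=\eta/\varepsilon$: every $\bm{x}\in\Omega$ has some $\bm{p}_l\in S$ with $|\bm{x}-\bm{p}_l|\le\varepsilon$, and $|\bm{p}_l-\bm{p}_n|\ge\eta$ for all distinct $\bm{p}_l,\bm{p}_n\in S$. $\mathcal{T}$ is a triangulation of $\Omega$ whose vertices are the points of $S$: a finite set of non-overlapping (nondegenerate) $d$-simplices $K$ whose total hypervolume is that of $\Omega$, forming a pure simplicial $d$-complex, without hanging nodes, that is $d$-connected and in which each $(d-1)$-simplex (facet) has exactly one (boundary) or two (interior) $d$-simplex neighbors. The vertices of $K$ are $\bm{p}_{K,1},\dots,\bm{p}_{K,d+1}$, and $\bm{p}_{K,ij}=\bm{p}_{K,j}-\bm{p}_{K,i}$. $|K|$ is the $d$-dimensional volume of $K$, $\Delta(K)$ its diameter (longest edge length), and $R_{K,\min}$ its min-containment radius (radius of the smallest ball containing $K$). $\max_K$ is over $K\in\mathcal{T}$. Sizing function. $\mathcal{D}:\Omega\to(0,\infty)$ satisfies $1/\mathcal{D}^2\in C^2(\Omega)$. For each $K$, $\zeta_K\in\mathbb{R}$ is chosen so that $$\min_{1\le i\le d+1}\frac{1}{\mathcal{D}^2(\bm{p}_{K,i})}\le\frac{1}{\Delta(K)^2}+\zeta_K\le\max_{1\le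 i\le d+1}\frac{1}{\mathcal{D}^2(\bm{p}_{K,i})}.$$ For a $C^2$ function $g$, $\|g\|_{2,L_\infty(\Omega)}$ is the $L_\infty(\Omega)$ norm of $\bm{x}\mapsto\sup_{|\bm{u}_1|\le1,|\bm{u}_2|\le1}\left|\frac{\partial}{\partial\bm{u}_1}\frac{\partial}{\partial\bm{u}_2}g(\bm{x})\right|$, with $\partial/\partial\bm{u}$ the directional derivative. Functionals and norms. Piecewise $H^1$ means $v|_K\in H^1(K)$ for every $K\in\mathcal{T}$; $\nabla v$ is the elementwise gradient. For a vector field $\bm{g}:\Omega\to\mathbb{R}^d$, $$\Psi_{\mathcal{T}}(\bm{g})=\left[\sum_{K\in\mathcal{T}}\frac{1}{\Delta(K)^2}\int_K\sum_{i=1}^{d+1}\sum_{j=1}^{i-1}\big(\mathrm{abs}(\bm{g})\cdot\mathrm{abs}(\bm{p}_{K,ij})\big)^2dV\right]^{1/2},$$ where $\mathrm{abs}$ takes the absolute value of each component of a vector. $\|\bm{g}\|_{L_\infty(\Omega)}$ is the essential supremum of the Euclidean norm $|\bm{g}(\bm{x})|$ over $\Omega$. Interpolation. Fix a degree $k\ge0$, $N_p=\frac{(k+d)!}{k!\,d!}$, a reference $d$-simplex, and interpolation points $\bm{\xi}_1,\dots,\bm{\xi}_{N_p}$ in it that are unisolvent for polynomials of degree $\le k$; $L_1,\dots,L_{N_p}$ are the corresponding Lagrange polynomials of degree $\le k$, $L_j(\bm{\xi}_m)=1$ if $j=m$ and $0$ otherwise. For each $K$, $\bm{x}\mapsto\bm{\xi}(\bm{x})$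 is the affine bijection from $K$ to the reference simplex, and $\bm{x}_j\in K$ is the preimage of $\bm{\xi}_j$. On $K$, $(\nabla v)_h$ has components $\left(\frac{\partial v}{\partial x_i}\right)_h(\bm{x})=\sum_{j=1}^{N_p}\frac{\partial v}{\partial x_i}(\bm{x}_j)L_j(\bm{\xi}(\bm{x}))$, $i=1,\dots,d$, where point values are those of the continuous gradient on the closed simplex $K$. The Lebesgue constant is $\Lambda=\max_{\bm{\xi}}\sum_{m=1}^{N_p}|L_m(\bm{\xi})|$, maximum over the reference simplex. The best approximation $(\nabla v)^{\ast}$ is defined componentwise and elementwise: on each $K$, its $i$-th component $\left(\frac{\partial v}{\partial x_i}\right)^{\ast}$ is a polynomial of degree $\le k$ minimizing $\left\|\frac{\partial v}{\partial x_i}-q\right\|_{L_\infty(K)}$ over all polynomials $q$ of degree $\le k$. *)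

theory Defs
  imports "HOL-Probability.Essential_Supremum"
begin

section \<open>Meshes\<close>

text \<open>Throughout, $d$ is \<open>CARD('n)\<close>.\<close>

definition vertices :: "(real^'n) set \<Rightarrow> (real^'n) set"
  where "vertices K = {x. x extreme_point_of K}"

text \<open>An \<open>(\<epsilon>, \<eta>/\<epsilon>)\<close>-net; the second parameter here is the unscaled \<open>\<eta>\<close>.\<close>

definition eps_eta_net :: "real \<Rightarrow> real \<Rightarrow> (real^'n) set \<Rightarrow> bool"
  where "eps_eta_net \<epsilon> \<eta> S \<longleftrightarrow> 0 < \<epsilon> \<and> 0 < \<eta> \<and>
    (\<forall>x \<in> convex hull S. \<exists>p\<in>S. norm (x - p) \<le> \<epsilon>) \<and>
    (\<forall>p\<in>S. \<forall>q\<in>S. p \<noteq> q \<longrightarrow> \<eta> \<le> norm (p - q))"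

definition facet_adjacent :: "(real^'n) set set \<Rightarrow> ((real^'n) set \<times> (real^'n) set) set"
  where "facet_adjacent T =
    {(K, K'). K \<in> T \<and> K' \<in> T \<and> (\<exists>F. F facet_of K \<and> F facet_of K')}"

text \<open>\<open>T\<close> consists of the closed $d$-simplices only. The complex it generates (all faces of
  members of \<open>T\<close>) is pure by construction. The condition on \<open>K \<inter> S\<close> excludes hanging
  nodes. ``$d$-connected'' means that any two $d$-simplices
  are joined by a chain in which neighbours share a facet.\<close>

definition mesh_of :: "(real^'n) set \<Rightarrow> (real^'n) set set \<Rightarrow> bool"
  where "mesh_of S T \<longleftrightarrow>
    finite T \<and>
    (\<forall>K\<in>T. int CARD('n) simplex K) \<and>
    pairwise (\<lambda>K K'. interior K \<inter> interior K' = {}) T \<and>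
    (\<Sum>K\<in>T. measure lebesgue K) = measure lebesgue (convex hull S) \<and>
    (\<Union>K\<in>T. vertices K) = S \<and>
    simplicial_complex {F. \<exists>K\<in>T. F face_of K} \<and>
    (\<forall>K\<in>T. K \<inter> S = vertices K) \<and>
    (\<forall>K\<in>T. \<forall>K'\<in>T. (K, K') \<in> (facet_adjacent T)\<^sup>*) \<and>
    (\<forall>F. (\<exists>K\<in>T. F facet_of K) \<longrightarrow>
       card {K\<in>T. F facet_of K} = (if F \<subseteq> frontier (convex hull S) then 1 else 2))"

definition min_containment_radius :: "(real^'n) set \<Rightarrow> real"
  where "min_containment_radius K = Inf {r. 0 \<le> r \<and> (\<exists>c. K \<subseteq> cball c r)}"

text \<open>A field given simplex by simplex, as a single field defined almost everywhere on the
  domain; on the interfaces, a null set, the value is immaterial.\<close>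

definition glue :: "(real^'n) set set \<Rightarrow> ((real^'n) set \<Rightarrow> real^'n \<Rightarrow> real^'n) \<Rightarrow> real^'n \<Rightarrow> real^'n"
  where "glue T G x =
    (if \<exists>K\<in>T. x \<in> interior K then G (THE K. K \<in> T \<and> x \<in> interior K) x else 0)"


section \<open>Norms and smoothness\<close>

definition Linf_norm :: "(real^'n) set \<Rightarrow> (real^'n \<Rightarrow> 'b::real_normed_vector) \<Rightarrow> real"
  where "Linf_norm \<Omega> f = real_of_ereal (esssup (lebesgue_on \<Omega>) (\<lambda>x. ereal (norm (f x))))"

text \<open>$C^2$ up to the boundary. On a convex \<open>\<Omega>\<close> with nonempty interior the derivatives within
  \<open>\<Omega>\<close> are unique.\<close>

definition C2_on :: "(real^'n) set \<Rightarrow> (real^'n \<Rightarrow> real) \<Rightarrow> bool"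
  where "C2_on \<Omega> f \<longleftrightarrow> (\<exists>(G :: real^'n \<Rightarrow> real^'n) (H :: real^'n \<Rightarrow> real^'n^'n).
    (\<forall>x\<in>\<Omega>. (f has_derivative (\<lambda>h. G x \<bullet> h)) (at x within \<Omega>)) \<and>
    (\<forall>x\<in>\<Omega>. (G has_derivative (\<lambda>h. H x *v h)) (at x within \<Omega>)) \<and>
    continuous_on \<Omega> H)"

definition dir_deriv :: "real^'n \<Rightarrow> (real^'n \<Rightarrow> real) \<Rightarrow> real^'n \<Rightarrow> real"
  where "dir_deriv u g x = deriv (\<lambda>t. g (x + t *\<^sub>R u)) 0"

text \<open>For a function that is $C^2$ on \<open>\<Omega>\<close>, the directional derivatives below are the true ones
  at every interior point; the frontier of the domain is a null set.\<close>

definition Linf_norm2 :: "(real^'n) set \<Rightarrow> (real^'n \<Rightarrow> real) \<Rightarrow> real"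
  where "Linf_norm2 \<Omega> g =
    Linf_norm \<Omega> (\<lambda>x. SUP (u1, u2) \<in> cball 0 1 \<times> cball 0 1. \<bar>dir_deriv u1 (dir_deriv u2 g) x\<bar>)"


section \<open>Piecewise Sobolev functions\<close>

text \<open>$C^\infty$: differentiable, with all directional derivatives again $C^\infty$.\<close>

coinductive smooth_fun :: "(real^'n \<Rightarrow> real) \<Rightarrow> bool"
  where "(\<And>x. f differentiable (at x)) \<Longrightarrow>
    (\<And>h. smooth_fun (\<lambda>x. frechet_derivative f (at x) h)) \<Longrightarrow> smooth_fun f"

definition test_fun :: "(real^'n) set \<Rightarrow> (real^'n \<Rightarrow> real) \<Rightarrow> bool"
  where "test_fun U \<phi> \<longleftrightarrow>
    smooth_fun \<phi> \<and> compact (closure {x. \<phi> x \<noteq> 0}) \<and> closure {x. \<phi> x \<noteq> 0} \<subseteq> U"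

definition weak_gradient_on ::
    "(real^'n) set \<Rightarrow> (real^'n \<Rightarrow> real) \<Rightarrow> (real^'n \<Rightarrow> real^'n) \<Rightarrow> bool"
  where "weak_gradient_on U v g \<longleftrightarrow>
    (\<forall>C. compact C \<and> C \<subseteq> U \<longrightarrow> integrable (lebesgue_on C) v \<and> integrable (lebesgue_on C) g) \<and>
    (\<forall>\<phi>. test_fun U \<phi> \<longrightarrow> (\<forall>i.
       (\<integral>x. v x * frechet_derivative \<phi> (at x) (axis i 1) \<partial>lebesgue_on U) =
       - (\<integral>x. g x $ i * \<phi> x \<partial>lebesgue_on U)))"

definition L2_on :: "(real^'n) set \<Rightarrow> (real^'n \<Rightarrow> 'b::euclidean_space) \<Rightarrow> bool"
  where "L2_on U f \<longleftrightarrow>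
    f \<in> borel_measurable (lebesgue_on U) \<and> integrable (lebesgue_on U) (\<lambda>x. (norm (f x))\<^sup>2)"

definition H1_on :: "(real^'n) set \<Rightarrow> (real^'n \<Rightarrow> real) \<Rightarrow> bool"
  where "H1_on U v \<longleftrightarrow> L2_on U v \<and> (\<exists>g. weak_gradient_on U v g \<and> L2_on U g)"

definition continuous_gradient ::
    "(real^'n) set \<Rightarrow> (real^'n \<Rightarrow> real) \<Rightarrow> (real^'n \<Rightarrow> real^'n) \<Rightarrow> bool"
  where "continuous_gradient K v g \<longleftrightarrow> continuous_on K g \<and> weak_gradient_on (interior K) v g"

text \<open>The continuous representative of the gradient on the closed simplex \<open>K\<close>; its values on
  \<open>K\<close> are uniquely determined by \<open>v\<close>, being continuous on the closure of the interior of \<open>K\<close>.\<close>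

definition grad_on :: "(real^'n \<Rightarrow> real) \<Rightarrow> (real^'n) set \<Rightarrow> real^'n \<Rightarrow> real^'n"
  where "grad_on v K = (SOME g. continuous_gradient K v g)"


section \<open>Polynomials and interpolation\<close>

definition polys :: "nat \<Rightarrow> (real^'n \<Rightarrow> real) set"
  where "polys k = {q. \<exists>c :: ('n \<Rightarrow> nat) \<Rightarrow> real.
    q = (\<lambda>x. \<Sum>\<alpha> | (\<Sum>i\<in>UNIV. \<alpha> i) \<le> k. c \<alpha> * (\<Prod>i\<in>UNIV. (x $ i) ^ \<alpha> i))}"

definition num_points :: "nat \<Rightarrow> nat \<Rightarrow> nat"
  where "num_points k d = fact (k + d) div (fact k * fact d)"

definition unisolvent :: "nat \<Rightarrow> (nat \<Rightarrow> real^'n) \<Rightarrow> bool"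
  where "unisolvent k \<xi> \<longleftrightarrow>
    (\<forall>y :: nat \<Rightarrow> real. \<exists>!q. q \<in> polys k \<and> (\<forall>j \<in> {1..num_points k CARD('n)}. q (\<xi> j) = y j))"

definition lagrange :: "nat \<Rightarrow> (nat \<Rightarrow> real^'n) \<Rightarrow> nat \<Rightarrow> real^'n \<Rightarrow> real"
  where "lagrange k \<xi> j = (THE q. q \<in> polys k \<and>
    (\<forall>m \<in> {1..num_points k CARD('n)}. q (\<xi> m) = (if j = m then 1 else 0)))"

definition lebesgue_constant :: "nat \<Rightarrow> (real^'n) set \<Rightarrow> (nat \<Rightarrow> real^'n) \<Rightarrow> real"
  where "lebesgue_constant k Kref \<xi> =
    (SUP x\<in>Kref. \<Sum>m = 1..num_points k CARD('n). \<bar>lagrange k \<xi> m x\<bar>)"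

definition affine_bijection ::
    "(real^'n \<Rightarrow> real^'n) \<Rightarrow> (real^'n) set \<Rightarrow> (real^'n) set \<Rightarrow> bool"
  where "affine_bijection \<phi> K Kref \<longleftrightarrow>
    bij_betw \<phi> K Kref \<and> (\<exists>A b. linear A \<and> (\<forall>x\<in>K. \<phi> x = A x + b))"

text \<open>\<open>\<phi> K\<close> is the affine map from \<open>K\<close> to the reference simplex.\<close>

definition interpolant ::
    "nat \<Rightarrow> (nat \<Rightarrow> real^'n) \<Rightarrow> ((real^'n) set \<Rightarrow> real^'n \<Rightarrow> real^'n) \<Rightarrow>
     ((real^'n) set \<Rightarrow> real^'n \<Rightarrow> real^'n) \<Rightarrow> (real^'n) set \<Rightarrow> real^'n \<Rightarrow> real^'n"
  where "interpolant k \<xi> \<phi> G K x =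
    (\<chi> i. \<Sum>j = 1..num_points k CARD('n).
       G K (inv_into K (\<phi> K) (\<xi> j)) $ i * lagrange k \<xi> j (\<phi> K x))"

definition best_approximation ::
    "nat \<Rightarrow> (real^'n) set \<Rightarrow> (real^'n \<Rightarrow> real) \<Rightarrow> (real^'n \<Rightarrow> real) \<Rightarrow> bool"
  where "best_approximation k K f q \<longleftrightarrow> q \<in> polys k \<and>
    (\<forall>r \<in> polys k. Linf_norm K (\<lambda>x. f x - q x) \<le> Linf_norm K (\<lambda>x. f x - r x))"


section \<open>The functional and the constants\<close>

text \<open>\<open>p K 1, \<dots>, p K (d+1)\<close> enumerate the vertices of \<open>K\<close>. On \<open>real^'n\<close> the absolute value
  \<open>\<bar>_\<bar>\<close> is taken componentwise.\<close>

definition Psi ::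
    "(real^'n) set set \<Rightarrow> ((real^'n) set \<Rightarrow> nat \<Rightarrow> real^'n) \<Rightarrow> (real^'n \<Rightarrow> real^'n) \<Rightarrow> real"
  where "Psi T p g = sqrt (\<Sum>K\<in>T. 1 / (diameter K)\<^sup>2 *
    (\<integral>x. (\<Sum>i = 1..CARD('n) + 1. \<Sum>j\<in>{1..<i}. (\<bar>g x\<bar> \<bullet> \<bar>p K j - p K i\<bar>)\<^sup>2) \<partial>lebesgue_on K))"

definition Theta :: "(real^'n) set set \<Rightarrow> ((real^'n) set \<Rightarrow> nat \<Rightarrow> real^'n) \<Rightarrow> real"
  where "Theta T p = (\<Sum>K\<in>T. \<Sum>i = 1..CARD('n) + 1. \<Sum>j\<in>{1..<i}.
    ((p K j - p K i) \<bullet> (p K j - p K i)) * measure lebesgue K)"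

definition C3 ::
    "(real^'n) set \<Rightarrow> (real^'n) set set \<Rightarrow> (real^'n \<Rightarrow> real) \<Rightarrow> ((real^'n) set \<Rightarrow> real) \<Rightarrow> real \<Rightarrow> real"
  where "C3 S T D \<zeta> \<eta> = sqrt (min
    (1/2 * Max ((\<lambda>K. (min_containment_radius K)\<^sup>2) ` T) *
        Linf_norm2 (convex hull S) (\<lambda>x. 1 / (D x)\<^sup>2) +
      Linf_norm (convex hull S) (\<lambda>x. 1 / (D x)\<^sup>2) +
      Max ((\<lambda>K. \<bar>\<zeta> K\<bar>) ` T))
    (1 / \<eta>\<^sup>2))"

end

theory Submission
  imports Defs
begin

text \<open>
  Write \<open>g\<close> for the gradient of \<open>v\<close>, \<open>q\<close> for its piecewise best approximation and \<open>I\<close> for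
  interpolation. On one simplex \<open>K\<close> the operator \<open>I\<close> reproduces polynomials of degree at most
  \<open>k\<close>, so \<open>g - I g = (g - q) - I (g - q)\<close>, and the second term is a combination of values of
  \<open>g - q\<close> at points of \<open>K\<close> whose weights have absolute values adding up to at most \<open>\<Lambda>\<close>. Hence
  the Euclidean norm of \<open>g - I g\<close> is at most \<open>1 + \<Lambda>\<close> times the maximum over \<open>K\<close> of that of
  \<open>g - q\<close> (\<open>norm_interpolation_error_le\<close>).

  The nodal values of \<open>g - q\<close> may lie on the boundary of \<open>K\<close>, whereas the \<open>L\<^sub>\<infinity>\<close> norm over the
  domain ignores null sets. Continuity of \<open>g - q\<close> up to the boundary closes this gap: an
  essential bound on a continuous field over an open set holds at every point of the closure
  (\<open>continuous_norm_le_Linf_norm\<close>). The same lemma bounds \<open>1 / D\<^sup>2\<close> at the mesh vertices, which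
  are all that the condition on \<open>\<zeta>\<close> speaks about, by its \<open>L\<^sub>\<infinity>\<close> norm.

  With this uniform bound on the error, the Cauchy--Schwarz inequality for each edge
  (\<open>edge_energy_integral_le\<close>) reduces the claim to \<open>1 / \<Delta>(K)\<^sup>2 \<le> C\<^sub>3\<^sup>2\<close> for every \<open>K\<close>. The
  alternative \<open>1 / \<eta>\<^sup>2\<close> in the minimum comes from \<open>K\<close> having an edge of length at least \<open>\<eta>\<close>;
  the other one from \<open>1 / \<Delta>(K)\<^sup>2 \<le> max 1 / D\<^sup>2 - \<zeta>\<^sub>K\<close>, to which the nonnegative second-order
  term may be added.
\<close>

section \<open>Polynomials of bounded total degree\<close>

lemma finite_exponents: "finite {\<alpha> :: 'n::finite \<Rightarrow> nat. (\<Sum>i\<in>UNIV. \<alpha> i) \<le> k}"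
proof (rule finite_subset)
  show "{\<alpha> :: 'n \<Rightarrow> nat. (\<Sum>i\<in>UNIV. \<alpha> i) \<le> k} \<subseteq> PiE UNIV (\<lambda>_. {..k})"
  proof
    fix \<alpha> :: "'n \<Rightarrow> nat"
    assume "\<alpha> \<in> {\<alpha>. (\<Sum>i\<in>UNIV. \<alpha> i) \<le> k}"
    moreover have "\<alpha> i \<le> (\<Sum>i\<in>UNIV. \<alpha> i)" for i
      by (rule member_le_sum) auto
    ultimately show "\<alpha> \<in> PiE UNIV (\<lambda>_. {..k})"
      by (auto intro: order_trans)
  qed
qed (auto intro: finite_PiE)

lemma polys_monomial:
  fixes \<alpha> :: "'n::finite \<Rightarrow> nat"
  assumes "(\<Sum>i\<in>UNIV. \<alpha> i) \<le> k"
  shows "(\<lambda>x::real^'n. c * (\<Prod>i\<in>UNIV. (x $ i) ^ \<alpha> i)) \<in> polys k"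
proof -
  have "(\<Sum>\<beta> | (\<Sum>i\<in>UNIV. \<beta> i) \<le> k.
          (if \<beta> = \<alpha> then c else 0) * (\<Prod>i\<in>UNIV. (x $ i) ^ \<beta> i)) =
        c * (\<Prod>i\<in>UNIV. (x $ i) ^ \<alpha> i)" for x :: "real^'n"
    using assms by (simp add: if_distrib[of "\<lambda>t. t * _"] finite_exponents sum.delta cong: if_cong)
  then show ?thesis
    unfolding polys_def by (intro CollectI exI[of _ "\<lambda>\<beta>. if \<beta> = \<alpha> then c else 0"]) simp
qed

lemma polys_const: "(\<lambda>x::real^'n. c) \<in> polys k"
  using polys_monomial[of "\<lambda>_. 0" k c] by simp

lemma polys_coordinate: "(\<lambda>x::real^'n. x $ j) \<in> polys 1"
proof -
  have "(\<Prod>i\<in>UNIV. (x $ i) ^ (if i = j then 1 else 0)) = x $ j" for x :: "real^'n"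
    by (simp add: if_distrib[of "\<lambda>t. _ ^ t"] cong: if_cong)
  then show ?thesis
    using polys_monomial[of "\<lambda>i. if i = j then 1 else 0" 1 1] by simp
qed

lemma polys_add:
  assumes "q \<in> polys k" "r \<in> polys k"
  shows "(\<lambda>x. q x + r x) \<in> polys k"
proof -
  from assms obtain c d where
    "q = (\<lambda>x. \<Sum>\<alpha> | (\<Sum>i\<in>UNIV. \<alpha> i) \<le> k. c \<alpha> * (\<Prod>i\<in>UNIV. (x $ i) ^ \<alpha> i))"
    "r = (\<lambda>x. \<Sum>\<alpha> | (\<Sum>i\<in>UNIV. \<alpha> i) \<le> k. d \<alpha> * (\<Prod>i\<in>UNIV. (x $ i) ^ \<alpha> i))"
    unfolding polys_def by blast
  then show ?thesis
    unfolding polys_def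
    by (intro CollectI exI[of _ "\<lambda>\<alpha>. c \<alpha> + d \<alpha>"]) (simp add: sum.distrib distrib_right)
qed

lemma polys_sum:
  assumes "\<And>a. a \<in> A \<Longrightarrow> q a \<in> polys k"
  shows "(\<lambda>x. \<Sum>a\<in>A. q a x) \<in> polys k"
  using assms
  by (induction A rule: infinite_finite_induct) (auto intro: polys_add polys_const)

lemma polys_mult:
  fixes q r :: "real^'n \<Rightarrow> real"
  assumes "q \<in> polys k" "r \<in> polys l"
  shows "(\<lambda>x. q x * r x) \<in> polys (k + l)"
proof -
  from assms obtain c d where
    q: "q = (\<lambda>x. \<Sum>\<alpha> | (\<Sum>i\<in>UNIV. \<alpha> i) \<le> k. c \<alpha> * (\<Prod>i\<in>UNIV. (x $ i) ^ \<alpha> i))" and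
    r: "r = (\<lambda>x. \<Sum>\<alpha> | (\<Sum>i\<in>UNIV. \<alpha> i) \<le> l. d \<alpha> * (\<Prod>i\<in>UNIV. (x $ i) ^ \<alpha> i))"
    unfolding polys_def by blast
  have "q x * r x = (\<Sum>\<alpha> | (\<Sum>i\<in>UNIV. \<alpha> i) \<le> k. \<Sum>\<beta> | (\<Sum>i\<in>UNIV. \<beta> i) \<le> l.
      c \<alpha> * d \<beta> * (\<Prod>i\<in>UNIV. (x $ i) ^ (\<alpha> i + \<beta> i)))" for x
    by (simp add: q r sum_product power_add prod.distrib mult_ac)
  moreover have "(\<lambda>x::real^'n. \<Sum>\<alpha> | (\<Sum>i\<in>UNIV. \<alpha> i) \<le> k. \<Sum>\<beta> | (\<Sum>i\<in>UNIV. \<beta> i) \<le> l.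
      c \<alpha> * d \<beta> * (\<Prod>i\<in>UNIV. (x $ i) ^ (\<alpha> i + \<beta> i))) \<in> polys (k + l)"
    by (intro polys_sum polys_monomial) (auto simp: sum.distrib intro: add_mono)
  ultimately show ?thesis
    by simp
qed

lemma polys_mono:
  fixes q :: "real^'n \<Rightarrow> real"
  assumes "q \<in> polys k" "k \<le> l"
  shows "q \<in> polys l"
  using polys_mult[OF assms(1) polys_const[of 1 "l - k"]] assms(2) by simp

lemma polys_prod:
  fixes q :: "'a \<Rightarrow> real^'n \<Rightarrow> real"
  assumes "\<And>a. a \<in> A \<Longrightarrow> q a \<in> polys (m a)"
  shows "(\<lambda>x. \<Prod>a\<in>A. q a x) \<in> polys (\<Sum>a\<in>A. m a)"
  using assms
  by (induction A rule: infinite_finite_induct) (auto intro: polys_mult polys_const)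

lemma polys_power:
  fixes q :: "real^'n \<Rightarrow> real"
  assumes "q \<in> polys k"
  shows "(\<lambda>x. q x ^ m) \<in> polys (m * k)"
  by (induction m) (auto intro: polys_mult polys_const assms)

text \<open>Each coordinate of an affine map is a polynomial of degree at most one, so an affine
  substitution sends a monomial to a product of that many factors of degree at most one. This is
  what transports polynomials between a mesh simplex and the reference simplex.\<close>

lemma polys_compose_affine:
  fixes q :: "real^'n \<Rightarrow> real" and A :: "real^'n \<Rightarrow> real^'n"
  assumes "q \<in> polys k" "linear A"
  shows "(\<lambda>x. q (A x + b)) \<in> polys k"
proof -
  from assms(1) obtain c where
    q: "q = (\<lambda>x. \<Sum>\<alpha> | (\<Sum>i\<in>UNIV. \<alpha> i) \<le> k. c \<alpha> * (\<Prod>i\<in>UNIV. (x $ i) ^ \<alpha> i))"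
    unfolding polys_def by blast
  define a where "a i j = A (axis j 1) $ i" for i j
  have A: "A x $ i = (\<Sum>j\<in>UNIV. a i j * x $ j)" for x i
    using Cartesian_Space.linear_componentwise[of A x i] assms(2)
    by (simp add: a_def linear_matrix_vector_mul_eq mult.commute)
  have coord: "(\<lambda>x. (A x + b) $ i) \<in> polys 1" for i
  proof -
    have "(\<lambda>x::real^'n. (\<Sum>j\<in>UNIV. a i j * x $ j) + b $ i) \<in> polys (0 + 1)"
      by (intro polys_add polys_sum polys_mult polys_coordinate polys_const)
    then show ?thesis by (simp add: A)
  qed
  have "(\<lambda>x. c \<alpha> * (\<Prod>i\<in>UNIV. ((A x + b) $ i) ^ \<alpha> i)) \<in> polys k"
    if "(\<Sum>i\<in>UNIV. \<alpha> i) \<le> k" for \<alpha>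
  proof -
    have "(\<lambda>x. c \<alpha> * (\<Prod>i\<in>UNIV. ((A x + b) $ i) ^ \<alpha> i)) \<in> polys (0 + (\<Sum>i\<in>UNIV. \<alpha> i * 1))"
      by (intro polys_mult polys_prod polys_power polys_const coord)
    then show ?thesis
      using that by (auto elim: polys_mono)
  qed
  then show ?thesis
    unfolding q by (intro polys_sum) auto
qed

lemma continuous_on_polys:
  assumes "q \<in> polys k"
  shows "continuous_on X q"
  using assms unfolding polys_def by (auto intro!: continuous_intros)


section \<open>Stability of Lagrange interpolation\<close>

lemma
  fixes \<xi> :: "nat \<Rightarrow> real^'n"
  assumes "unisolvent k \<xi>"
  shows lagrange_in_polys: "lagrange k \<xi> j \<in> polys k"
    and lagrange_at_node:
      "m \<in> {1..num_points k CARD('n)} \<Longrightarrow> lagrange k \<xi> j (\<xi> m) = (if j = m then 1 else 0)"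
proof -
  have "\<exists>!q. q \<in> polys k \<and>
      (\<forall>m \<in> {1..num_points k CARD('n)}. q (\<xi> m) = (if j = m then 1 else 0))"
    using assms unfolding unisolvent_def by (elim allE[of _ "\<lambda>m. if j = m then 1 else 0"])
  from theI'[OF this]
  show "lagrange k \<xi> j \<in> polys k"
    and "m \<in> {1..num_points k CARD('n)} \<Longrightarrow> lagrange k \<xi> j (\<xi> m) = (if j = m then 1 else 0)"
    unfolding lagrange_def by auto
qed

lemma lagrange_reproduces_polys:
  fixes \<xi> :: "nat \<Rightarrow> real^'n"
  assumes "unisolvent k \<xi>" "r \<in> polys k"
  shows "r y = (\<Sum>j = 1..num_points k CARD('n). r (\<xi> j) * lagrange k \<xi> j y)"
proof -
  let ?s = "\<lambda>y. \<Sum>j = 1..num_points k CARD('n). r (\<xi> j) * lagrange k \<xi> j y"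
  have "?s \<in> polys (0 + k)"
    by (intro polys_sum polys_mult polys_const lagrange_in_polys assms)
  moreover have "?s (\<xi> m) = r (\<xi> m)" if "m \<in> {1..num_points k CARD('n)}" for m
  proof -
    have "?s (\<xi> m) = (\<Sum>j = 1..num_points k CARD('n). if j = m then r (\<xi> j) else 0)"
      using lagrange_at_node[OF assms(1) that] by (intro sum.cong) auto
    then show ?thesis using that by simp
  qed
  moreover have "\<exists>!q. q \<in> polys k \<and>
      (\<forall>m \<in> {1..num_points k CARD('n)}. q (\<xi> m) = r (\<xi> m))"
    using assms(1) unfolding unisolvent_def by (elim allE[of _ "\<lambda>m. r (\<xi> m)"])
  ultimately have "?s = r"
    using assms(2) by auto
  then show ?thesis by metis
qed

lemma sum_lagrange_le_lebesgue_constant: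
  fixes \<xi> :: "nat \<Rightarrow> real^'n"
  assumes "unisolvent k \<xi>" "compact Kref" "y \<in> Kref"
  shows "(\<Sum>m = 1..num_points k CARD('n). \<bar>lagrange k \<xi> m y\<bar>) \<le> lebesgue_constant k Kref \<xi>"
proof -
  have "continuous_on Kref (\<lambda>x. \<Sum>m = 1..num_points k CARD('n). \<bar>lagrange k \<xi> m x\<bar>)"
    by (intro continuous_on_sum continuous_on_rabs continuous_on_polys[OF lagrange_in_polys] assms)
  then have "bdd_above ((\<lambda>x. \<Sum>m = 1..num_points k CARD('n). \<bar>lagrange k \<xi> m x\<bar>) ` Kref)"
    by (intro bounded_imp_bdd_above compact_imp_bounded compact_continuous_image assms(2))
  then show ?thesis
    unfolding lebesgue_constant_def using assms(3) by (intro cSUP_upper)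
qed

lemma affine_bijection_left_inverse:
  fixes \<phi> :: "real^'n \<Rightarrow> real^'n"
  assumes "affine_bijection \<phi> K Kref" "interior K \<noteq> {}"
  obtains B c where "linear B" "\<And>x. x \<in> K \<Longrightarrow> B (\<phi> x) + c = x"
proof -
  from assms(1) obtain A b where bij: "bij_betw \<phi> K Kref" and A: "linear A"
    and \<phi>: "\<And>x. x \<in> K \<Longrightarrow> \<phi> x = A x + b"
    unfolding affine_bijection_def by blast
  \<comment> \<open>A ball inside \<open>K\<close> turns injectivity on \<open>K\<close> into injectivity of the linear part.\<close>
  from assms(2) obtain a e where e: "e > 0" "cball a e \<subseteq> K"
    by (auto simp: mem_interior_cball)
  have "inj A"
  proof (subst linear_injective_0[OF A], intro allI impI)
    fix z assume z: "A z = 0"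
    show "z = 0"
    proof (rule ccontr)
      assume "z \<noteq> 0"
      define y where "y = a + (e / norm z) *\<^sub>R z"
      have "y \<in> K" "a \<in> K"
        using e \<open>z \<noteq> 0\<close> by (auto simp: y_def dist_norm intro!: subsetD[OF e(2)])
      moreover have "A y = A a"
        by (simp add: y_def linear_add[OF A] linear_scale[OF A] z)
      ultimately have "y = a"
        using bij \<phi> by (auto simp: bij_betw_def inj_on_def)
      then show False using e \<open>z \<noteq> 0\<close> by (simp add: y_def)
    qed
  qed
  then obtain B where B: "linear B" "B \<circ> A = id"
    using linear_injective_left_inverse[OF A] by blast
  have "B (\<phi> x) + (- B b) = x" if "x \<in> K" for x
    using that B by (simp add: \<phi> linear_add[OF B(1)] fun_eq_iff)
  with B(1) show ?thesis by (rule that)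
qed

text \<open>Lebesgue's lemma: interpolation reproduces the polynomial field \<open>q\<close>, so the interpolation
  error of \<open>G\<close> is that of \<open>G - q\<close>. Applying this to vectors and not to each component separately
  keeps the Euclidean norm on both sides, with no factor depending on the dimension.\<close>

lemma norm_interpolation_error_le:
  fixes G :: "(real^'n) set \<Rightarrow> real^'n \<Rightarrow> real^'n" and q :: "real^'n \<Rightarrow> real^'n"
  assumes uni: "unisolvent k \<xi>" and "compact Kref"
    and nodes: "\<And>j. j \<in> {1..num_points k CARD('n)} \<Longrightarrow> \<xi> j \<in> Kref"
    and aff: "affine_bijection (\<phi> K) K Kref" and "interior K \<noteq> {}"
    and q: "\<And>i. (\<lambda>x. q x $ i) \<in> polys k"
    and M: "\<And>x. x \<in> K \<Longrightarrow> norm (G K x - q x) \<le> M" and x: "x \<in> K"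
  shows "norm (G K x - interpolant k \<xi> \<phi> G K x) \<le> (1 + lebesgue_constant k Kref \<xi>) * M"
proof -
  let ?J = "{1..num_points k CARD('n)}"
  let ?L = "\<lambda>j. lagrange k \<xi> j (\<phi> K x)"
  define z where "z j = inv_into K (\<phi> K) (\<xi> j)" for j
  have bij: "bij_betw (\<phi> K) K Kref"
    using aff unfolding affine_bijection_def by blast
  have z: "z j \<in> K" "\<phi> K (z j) = \<xi> j" if "j \<in> ?J" for j
    using nodes[OF that] bij unfolding z_def bij_betw_def
    by (auto intro: inv_into_into f_inv_into_f)
  have \<phi>x: "\<phi> K x \<in> Kref"
    using bij x unfolding bij_betw_def by blast
  have "0 \<le> M"
    using M[OF x] norm_ge_zero order_trans by blast
  obtain B c where B: "linear B" and inv: "\<And>x. x \<in> K \<Longrightarrow> B (\<phi> K x) + c = x"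
    using affine_bijection_left_inverse[OF aff \<open>interior K \<noteq> {}\<close>] by blast
  have q_eq: "q x = (\<Sum>j\<in>?J. ?L j *\<^sub>R q (z j))"
  proof (subst vec_eq_iff, intro allI)
    fix i
    \<comment> \<open>The component of \<open>q\<close>, seen from the reference simplex, is reproduced there.\<close>
    have "q (B (\<phi> K x) + c) $ i = (\<Sum>j\<in>?J. q (B (\<xi> j) + c) $ i * ?L j)"
      by (rule lagrange_reproduces_polys[OF uni polys_compose_affine[OF q B]])
    also have "\<dots> = (\<Sum>j\<in>?J. q (z j) $ i * ?L j)"
      using z inv by (intro sum.cong refl) metis
    finally show "q x $ i = (\<Sum>j\<in>?J. ?L j *\<^sub>R q (z j)) $ i"
      using x inv by (simp add: mult.commute)
  qed
  have "interpolant k \<xi> \<phi> G K x = (\<Sum>j\<in>?J. ?L j *\<^sub>R G K (z j))"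
    by (simp add: interpolant_def z_def vec_eq_iff mult.commute)
  then have "G K x - interpolant k \<xi> \<phi> G K x =
      (G K x - q x) - (\<Sum>j\<in>?J. ?L j *\<^sub>R (G K (z j) - q (z j)))"
    by (simp add: q_eq scaleR_diff_right sum_subtractf)
  also have "norm \<dots> \<le> norm (G K x - q x) + norm (\<Sum>j\<in>?J. ?L j *\<^sub>R (G K (z j) - q (z j)))"
    by (rule norm_triangle_ineq4)
  also have "\<dots> \<le> M + (\<Sum>j\<in>?J. \<bar>?L j\<bar> * M)"
    using M[OF x] by (intro add_mono sum_norm_le) (auto intro!: mult_left_mono M z)
  also have "\<dots> = (1 + (\<Sum>j\<in>?J. \<bar>?L j\<bar>)) * M"
    by (simp add: sum_distrib_right distrib_right)
  also have "\<dots> \<le> (1 + lebesgue_constant k Kref \<xi>) * M"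
    using sum_lagrange_le_lebesgue_constant[OF uni \<open>compact Kref\<close> \<phi>x] \<open>0 \<le> M\<close>
    by (intro mult_right_mono) auto
  finally show ?thesis .
qed


section \<open>Essential and pointwise bounds\<close>

lemma Linf_norm_nonneg: "0 \<le> Linf_norm \<Omega> f"
proof (cases "esssup (lebesgue_on \<Omega>) (\<lambda>x. ereal (norm (f x))) < 0")
  case True
  \<comment> \<open>This happens only when the domain is a null set. The essential supremum is then \<open>-\<infinity>\<close>, which
    the conversion to the reals sends to 0.\<close>
  let ?M = "lebesgue_on \<Omega>"
  have meas: "(\<lambda>x. ereal (norm (f x))) \<in> borel_measurable ?M"
    using True by (auto simp: esssup_def split: if_splits)
  have "AE x in ?M. False"
    using esssup_AE[of "\<lambda>x. ereal (norm (f x))" ?M] True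
    by (elim eventually_mono) (metis ereal_less_eq(5) leD norm_ge_zero order_trans)
  then have "emeasure ?M (space ?M) = 0"
    using AE_iff_measurable[of "space ?M" ?M "\<lambda>_. False"] by auto
  then show ?thesis
    using esssup_zero_space[OF _ meas] by (simp add: Linf_norm_def)
qed (simp add: Linf_norm_def real_of_ereal_pos)

text \<open>The points of \<open>U\<close> where a continuous function exceeds an essential bound form an open null
  set, which is empty; by continuity the bound extends to the closure. The uniform bound \<open>B\<close> has
  a separate purpose: it keeps the essential supremum finite, since an infinite one would be
  converted to the real number 0.\<close>

lemma continuous_norm_le_Linf_norm:
  fixes f :: "real^'n \<Rightarrow> 'b::real_normed_vector"
  assumes "(\<lambda>x. norm (f x)) \<in> borel_measurable (lebesgue_on \<Omega>)" "\<Omega> \<in> sets lebesgue"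
    and bound: "\<And>x. x \<in> \<Omega> \<Longrightarrow> norm (f x) \<le> B"
    and U: "open U" "U \<subseteq> \<Omega>" and h: "continuous_on (closure U) h"
    and eq: "\<And>x. x \<in> U \<Longrightarrow> f x = h x" and x: "x \<in> closure U"
  shows "norm (h x) \<le> Linf_norm \<Omega> f"
proof (rule continuous_le_on_closure[OF _ x])
  let ?M = "lebesgue_on \<Omega>" and ?c = "Linf_norm \<Omega> f"
  let ?s = "esssup ?M (\<lambda>x. ereal (norm (f x)))"
  show "continuous_on (closure U) (\<lambda>x. norm (h x))"
    by (intro continuous_on_norm h)
  have "?s \<le> ereal B"
    using assms(1) bound by (intro esssup_I) (auto intro!: AE_I2 simp: space_restrict_space)
  have "AE x in ?M. norm (f x) \<le> ?c"
    using esssup_AE[of "\<lambda>x. ereal (norm (f x))" ?M] \<open>?s \<le> ereal B\<close>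
    by (elim eventually_mono) (cases ?s; simp add: Linf_norm_def)
  then have "AE x in lebesgue. x \<in> \<Omega> \<longrightarrow> norm (f x) \<le> ?c"
    using assms(2) by (subst (asm) AE_restrict_space_iff) auto
  moreover define V where "V = {x \<in> U. ?c < norm (h x)}"
  ultimately have "AE x in lebesgue. x \<notin> V"
    using U(2) eq by (elim eventually_mono) (auto simp: V_def)
  moreover have "open V"
  proof -
    have "continuous_on U (\<lambda>x. norm (h x))"
      using h closure_subset by (intro continuous_on_norm) (rule continuous_on_subset)
    then have "open (U \<inter> (\<lambda>x. norm (h x)) -` {?c<..})"
      using U(1) continuous_on_open_vimage open_greaterThan by (metis Int_commute)
    then show ?thesis by (simp add: V_def Int_def)
  qed
  ultimately have "negligible V"
    using AE_iff_null_sets[of V lebesgue] by (simp add: negligible_iff_null_sets)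
  with \<open>open V\<close> have "V = {}"
    using open_not_negligible by blast
  then show "norm (h x) \<le> ?c" if "x \<in> U" for x
    using that by (force simp: V_def)
qed


section \<open>Piecewise fields on a mesh\<close>

lemma glue_eq:
  assumes "pairwise (\<lambda>K K'. interior K \<inter> interior K' = {}) T" "K \<in> T" "x \<in> interior K"
  shows "glue T G x = G K x"
proof -
  have "(THE K. K \<in> T \<and> x \<in> interior K) = K"
    using assms by (intro the_equality) (auto simp: pairwise_def)
  then show ?thesis
    using assms by (auto simp: glue_def)
qed

lemma glue_eq_0: "(\<And>K. K \<in> T \<Longrightarrow> x \<notin> interior K) \<Longrightarrow> glue T G x = 0"
  by (auto simp: glue_def)

lemma borel_measurable_glue:
  fixes G :: "(real^'n) set \<Rightarrow> real^'n \<Rightarrow> real^'n"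
  assumes "finite T" and disj: "pairwise (\<lambda>K K'. interior K \<inter> interior K' = {}) T"
    and cont: "\<And>K. K \<in> T \<Longrightarrow> continuous_on (interior K) (G K)"
  shows "glue T G \<in> borel_measurable borel"
proof -
  have "glue T G x = (\<Sum>K\<in>T. indicator (interior K) x *\<^sub>R G K x)" for x
  proof (cases "\<exists>K\<in>T. x \<in> interior K")
    case True
    then obtain K where K: "K \<in> T" "x \<in> interior K" by blast
    have "(\<Sum>K'\<in>T. indicator (interior K') x *\<^sub>R G K' x) =
        (\<Sum>K'\<in>T. if K' = K then G K x else 0)"
      using disj K by (intro sum.cong) (auto simp: pairwise_def indicator_def)
    then show ?thesis
      using K \<open>finite T\<close> by (simp add: glue_eq[OF disj K])
  qed (simp add: glue_eq_0)
  moreover have "(\<lambda>x. \<Sum>K\<in>T. indicator (interior K) x *\<^sub>R G K x) \<in> borel_measurable borel"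
    by (intro borel_measurable_sum borel_measurable_continuous_on_indicator cont) auto
  ultimately show ?thesis
    by presburger
qed

lemma borel_measurable_lebesgue_on_borel:
  fixes f :: "real^'n \<Rightarrow> 'b::topological_space"
  shows "f \<in> borel_measurable borel \<Longrightarrow> f \<in> borel_measurable (lebesgue_on \<Omega>)"
  by (intro measurable_restrict_space1 measurable_completion) simp

lemma full_simplex_facts:
  fixes K :: "(real^'n) set"
  assumes "int CARD('n) simplex K"
  shows "compact K" "interior K \<noteq> {}" "closure (interior K) = K"
    "convex hull (vertices K) = K"
proof -
  show "compact K"
    by (rule compact_simplex[OF assms])
  have "convex K"
    by (rule convex_simplex[OF assms])
  show "interior K \<noteq> {}"
    using aff_dim_simplex[OF assms] interior_rel_interior_gen[of K] \<open>convex K\<close>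
    by (cases "K = {}") (auto simp: rel_interior_eq_empty)
  then show "closure (interior K) = K"
    using \<open>convex K\<close> \<open>compact K\<close> compact_imp_closed convex_closure_interior closure_closed by metis
  show "convex hull (vertices K) = K"
    unfolding vertices_def
    using Krein_Milman_Minkowski[OF \<open>compact K\<close> \<open>convex K\<close>] by simp
qed


section \<open>The functional\<close>

text \<open>Taking absolute values of the components preserves the Euclidean norm, so the
  Cauchy--Schwarz inequality bounds the integrand by \<open>m\<^sup>2\<close> times the squared edge lengths.\<close>

lemma edge_energy_integral_le:
  fixes g :: "real^'n \<Rightarrow> real^'n" and P :: "nat \<Rightarrow> real^'n"
  assumes bound: "\<And>x. x \<in> K \<Longrightarrow> norm (g x) \<le> m" and K: "K \<in> lmeasurable"
  shows "(\<integral>x. (\<Sum>i = 1..N. \<Sum>j\<in>{1..<i}. (\<bar>g x\<bar> \<bullet> \<bar>P j - P i\<bar>)\<^sup>2) \<partial>lebesgue_on K)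
    \<le> m\<^sup>2 * (\<Sum>i = 1..N. \<Sum>j\<in>{1..<i}. ((P j - P i) \<bullet> (P j - P i)) * measure lebesgue K)"
    (is "integral\<^sup>L ?M ?f \<le> m\<^sup>2 * ?E")
proof (cases "integrable ?M ?f")
  case True
  define e where "e = (\<Sum>i = 1..N. \<Sum>j\<in>{1..<i}. (P j - P i) \<bullet> (P j - P i))"
  have abs_norm: "norm \<bar>w\<bar> = norm w" for w :: "real^'n"
    by (simp add: norm_vec_def abs_vec_def)
  have le: "?f x \<le> m\<^sup>2 * e" if "x \<in> K" for x
    unfolding e_def sum_distrib_left
  proof (intro sum_mono)
    fix i j
    have "\<bar>\<bar>g x\<bar> \<bullet> \<bar>P j - P i\<bar>\<bar> \<le> norm (g x) * norm (P j - P i)"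
      using Cauchy_Schwarz_ineq2[of "\<bar>g x\<bar>" "\<bar>P j - P i\<bar>"] by (simp add: abs_norm)
    also have "\<dots> \<le> m * norm (P j - P i)"
      using bound[OF that] by (intro mult_right_mono) auto
    finally have "(\<bar>g x\<bar> \<bullet> \<bar>P j - P i\<bar>)\<^sup>2 \<le> (m * norm (P j - P i))\<^sup>2"
      using abs_le_square_iff by fastforce
    then show "(\<bar>g x\<bar> \<bullet> \<bar>P j - P i\<bar>)\<^sup>2 \<le> m\<^sup>2 * ((P j - P i) \<bullet> (P j - P i))"
      by (simp add: power_mult_distrib power2_norm_eq_inner)
  qed
  have fin: "finite_measure ?M"
    using K by (rule finite_measure_lebesgue_on)
  have "integral\<^sup>L ?M ?f \<le> integral\<^sup>L ?M (\<lambda>_. m\<^sup>2 * e)"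
    by (intro integral_mono True finite_measure.integrable_const[OF fin] le)
      (simp add: space_restrict_space)
  also have "\<dots> = m\<^sup>2 * e * measure lebesgue K"
    using K by (simp add: measure_restrict_space space_restrict_space fmeasurableD)
  also have "\<dots> = m\<^sup>2 * ?E"
    by (simp add: e_def sum_distrib_right mult.assoc)
  finally show ?thesis .
next
  case False
  \<comment> \<open>The integral is then 0 by convention.\<close>
  then show ?thesis
    by (simp add: not_integrable_integral_eq) (intro mult_nonneg_nonneg sum_nonneg; simp)
qed

theorem theorem13:
  fixes S :: "(real^'n) set"
    and T :: "(real^'n) set set"
    and \<epsilon> \<eta> :: real
    and p :: "(real^'n) set \<Rightarrow> nat \<Rightarrow> real^'n"
    and D v :: "real^'n \<Rightarrow> real"
    and \<zeta> :: "(real^'n) set \<Rightarrow> real"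
    and k :: nat
    and Kref :: "(real^'n) set"
    and \<xi> :: "nat \<Rightarrow> real^'n"
    and \<phi> gstar :: "(real^'n) set \<Rightarrow> real^'n \<Rightarrow> real^'n"
  assumes "finite S"
    and "aff_dim (convex hull S) = int CARD('n)"
    and "eps_eta_net \<epsilon> \<eta> S"
    and "mesh_of S T"
    and "\<And>K. K \<in> T \<Longrightarrow> bij_betw (p K) {1..CARD('n) + 1} (vertices K)"
    and "\<And>x. x \<in> convex hull S \<Longrightarrow> 0 < D x"
    and "C2_on (convex hull S) (\<lambda>x. 1 / (D x)\<^sup>2)"
    and "\<And>K. K \<in> T \<Longrightarrow>
          Min ((\<lambda>i. 1 / (D (p K i))\<^sup>2) ` {1..CARD('n) + 1}) \<le> 1 / (diameter K)\<^sup>2 + \<zeta> K"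
    and "\<And>K. K \<in> T \<Longrightarrow>
          1 / (diameter K)\<^sup>2 + \<zeta> K \<le> Max ((\<lambda>i. 1 / (D (p K i))\<^sup>2) ` {1..CARD('n) + 1})"
    and "int CARD('n) simplex Kref"
    and "\<And>j. j \<in> {1..num_points k CARD('n)} \<Longrightarrow> \<xi> j \<in> Kref"
    and "unisolvent k \<xi>"
    and "\<And>K. K \<in> T \<Longrightarrow> affine_bijection (\<phi> K) K Kref"
    and "\<And>K. K \<in> T \<Longrightarrow> H1_on (interior K) v"
    and "\<And>K. K \<in> T \<Longrightarrow> \<exists>g. continuous_gradient K v g"
    and "\<And>K i. K \<in> T \<Longrightarrow>
          best_approximation k K (\<lambda>x. grad_on v K x $ i) (\<lambda>x. gstar K x $ i)"
  shows "Psi T p (\<lambda>x. glue T (grad_on v) x - glue T (interpolant k \<xi> \<phi> (grad_on v)) x)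
    \<le> (1 + lebesgue_constant k Kref \<xi>) * C3 S T D \<zeta> \<eta> * sqrt (Theta T p) *
       Linf_norm (convex hull S) (\<lambda>x. glue T (grad_on v) x - glue T gstar x)"
proof (cases "T = {}")
  case True
  \<comment> \<open>The maxima inside the constant are meaningless here, but both sides vanish.\<close>
  then show ?thesis by (simp add: Psi_def Theta_def)
next
  case False
  note net = assms(3) and mesh = assms(4)
  let ?\<Omega> = "convex hull S" and ?\<Lambda> = "lebesgue_constant k Kref \<xi>" and ?N = "CARD('n) + 1"
  let ?err = "\<lambda>x. glue T (grad_on v) x - glue T gstar x"
  let ?f = "\<lambda>x. 1 / (D x)\<^sup>2"
  define M where "M = Linf_norm ?\<Omega> ?err"
  define g where "g x = glue T (grad_on v) x - glue T (interpolant k \<xi> \<phi> (grad_on v)) x" for x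
  have finT: "finite T" and disj: "pairwise (\<lambda>K K'. interior K \<inter> interior K' = {}) T"
    using mesh unfolding mesh_of_def by auto
  have simplex: "int CARD('n) simplex K" and vert: "vertices K \<subseteq> S" if "K \<in> T" for K
    using mesh that unfolding mesh_of_def by auto
  note facts = full_simplex_facts[OF simplex]
  have K_sub: "K \<subseteq> ?\<Omega>" if "K \<in> T" for K
    using hull_mono[OF vert[OF that], of convex] facts(4)[OF that] by simp
  have comp\<Omega>: "compact ?\<Omega>"
    using assms(1) by (rule finite_imp_compact_convex_hull)
  have meas\<Omega>: "?\<Omega> \<in> sets lebesgue"
    using comp\<Omega> lmeasurable_compact fmeasurableD by blast
  have M0: "0 \<le> M"
    unfolding M_def by (rule Linf_norm_nonneg)
  have compKref: "compact Kref" and "Kref \<noteq> {}"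
    using full_simplex_facts[OF assms(10)] by auto
  have \<Lambda>0: "0 \<le> ?\<Lambda>"
  proof -
    obtain y where "y \<in> Kref" using \<open>Kref \<noteq> {}\<close> by blast
    from sum_lagrange_le_lebesgue_constant[OF assms(12) compKref this]
    show ?thesis by (rule order_trans[rotated]) (auto intro: sum_nonneg)
  qed

  have gstar: "(\<lambda>x. gstar K x $ i) \<in> polys k" if "K \<in> T" for K i
    using assms(16)[OF that] unfolding best_approximation_def by blast
  have cont_star: "continuous_on X (gstar K)" if "K \<in> T" for K X
    using continuous_on_vec_lambda[of X "\<lambda>i x. gstar K x $ i"]
      continuous_on_polys[OF gstar[OF that]] by simp
  have cont_grad: "continuous_on K (grad_on v K)" if "K \<in> T" for K
    using someI_ex[OF assms(15)[OF that]] unfolding grad_on_def continuous_gradient_def by blast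
  have cont_err: "continuous_on K (\<lambda>x. grad_on v K x - gstar K x)" if "K \<in> T" for K
    using that by (intro continuous_on_diff cont_star cont_grad)

  have meas_err: "(\<lambda>x. norm (?err x)) \<in> borel_measurable (lebesgue_on ?\<Omega>)"
  proof -
    have "continuous_on (interior K) (grad_on v K)" if "K \<in> T" for K
      using cont_grad[OF that] interior_subset by (rule continuous_on_subset)
    then have "glue T (grad_on v) \<in> borel_measurable borel" "glue T gstar \<in> borel_measurable borel"
      using cont_star by (auto intro!: borel_measurable_glue finT disj)
    then show ?thesis
      by (intro borel_measurable_lebesgue_on_borel) measurable
  qed
  obtain B where B: "norm (?err x) \<le> B" for x
  proof -
    have "\<exists>b. \<forall>x\<in>K. norm (grad_on v K x - gstar K x) \<le> b" if "K \<in> T" for K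
      using compact_imp_bounded[OF compact_continuous_image[OF cont_err[OF that] facts(1)[OF that]]]
      by (auto simp: bounded_iff)
    then obtain b where b: "\<And>K x. K \<in> T \<Longrightarrow> x \<in> K \<Longrightarrow> norm (grad_on v K x - gstar K x) \<le> b K"
      by metis
    have "norm (?err x) \<le> (\<Sum>K\<in>T. \<bar>b K\<bar>)" for x
    proof (cases "\<exists>K\<in>T. x \<in> interior K")
      case True
      then obtain K where K: "K \<in> T" "x \<in> interior K" by blast
      then have "norm (?err x) \<le> \<bar>b K\<bar>"
        using b[OF K(1), of x] interior_subset[of K] by (simp add: glue_eq[OF disj K]) force
      also have "\<dots> \<le> (\<Sum>K\<in>T. \<bar>b K\<bar>)"
        using K finT by (intro member_le_sum) auto
      finally show ?thesis .
    qed (simp add: glue_eq_0 sum_nonneg)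
    then show ?thesis by (rule that)
  qed
  have err: "norm (grad_on v K x - gstar K x) \<le> M" if "K \<in> T" "x \<in> K" for K x
    unfolding M_def
  proof (rule continuous_norm_le_Linf_norm[OF meas_err meas\<Omega> B,
        where U = "interior K" and h = "\<lambda>x. grad_on v K x - gstar K x"])
    show "interior K \<subseteq> ?\<Omega>"
      using K_sub[OF that(1)] interior_subset by blast
    show "?err y = grad_on v K y - gstar K y" if "y \<in> interior K" for y
      using that \<open>K \<in> T\<close> by (simp add: glue_eq[OF disj])
  qed (use that facts cont_err in auto)

  \<comment> \<open>This holds also on the interfaces, where both glued fields are 0, so no null sets have to be
    discarded below.\<close>
  have g_le: "norm (g x) \<le> (1 + ?\<Lambda>) * M" for x
  proof (cases "\<exists>K\<in>T. x \<in> interior K")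
    case True
    then obtain K where K: "K \<in> T" "x \<in> interior K" by blast
    have "norm (grad_on v K x - interpolant k \<xi> \<phi> (grad_on v) K x) \<le> (1 + ?\<Lambda>) * M"
    proof (rule norm_interpolation_error_le[where q = "gstar K"])
      show "x \<in> K" using K interior_subset by blast
    qed (use K assms(11,12,13) compKref facts(2) gstar err in auto)
    then show ?thesis by (simp add: g_def glue_eq[OF disj K])
  qed (use \<Lambda>0 M0 in \<open>simp add: g_def glue_eq_0\<close>)

  have f_le: "?f x \<le> Linf_norm ?\<Omega> ?f" if "x \<in> ?\<Omega>" for x
  proof -
    from assms(7) have contf: "continuous_on ?\<Omega> ?f"
      unfolding C2_on_def
      by (meson continuous_on_eq_continuous_within has_derivative_continuous)
    have "convex ?\<Omega>" by (rule convex_convex_hull)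
    obtain K where "K \<in> T" using False by blast
    then have "interior ?\<Omega> \<noteq> {}"
      using facts(2) interior_mono[OF K_sub] by blast
    then have cl: "closure (interior ?\<Omega>) = ?\<Omega>"
      using comp\<Omega> by (simp add: convex_closure_interior compact_imp_closed)
    obtain b where "\<And>y. y \<in> ?\<Omega> \<Longrightarrow> norm (?f y) \<le> b"
      using compact_imp_bounded[OF compact_continuous_image[OF contf comp\<Omega>]]
      by (auto simp: bounded_iff)
    then have "norm (?f x) \<le> Linf_norm ?\<Omega> ?f"
    proof (rule continuous_norm_le_Linf_norm[OF _ meas\<Omega>, where U = "interior ?\<Omega>" and h = ?f, rotated])
      show "(\<lambda>x. norm (?f x)) \<in> borel_measurable (lebesgue_on ?\<Omega>)"
        by (intro continuous_imp_measurable_on_sets_lebesgue continuous_on_norm contf meas\<Omega>)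
    qed (use cl contf that in \<open>auto simp: interior_subset\<close>)
    then show ?thesis by simp
  qed

  let ?m = "min
    (1/2 * Max ((\<lambda>K. (min_containment_radius K)\<^sup>2) ` T) * Linf_norm2 ?\<Omega> ?f +
      Linf_norm ?\<Omega> ?f + Max ((\<lambda>K. \<bar>\<zeta> K\<bar>) ` T))
    (1 / \<eta>\<^sup>2)"
  have diam: "1 / (diameter K)\<^sup>2 \<le> ?m" if K: "K \<in> T" for K
  proof (rule min.boundedI)
    have vK: "p K i \<in> vertices K" if "i \<in> {1..?N}" for i
      using assms(5)[OF K] that unfolding bij_betw_def by blast
    have vK': "vertices K \<subseteq> K"
      by (auto simp: vertices_def extreme_point_of_def)
    have "1 / (diameter K)\<^sup>2 + \<zeta> K \<le> Linf_norm ?\<Omega> ?f"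
    proof (rule order_trans[OF assms(9)[OF K]], subst Max_le_iff; clarsimp?)
      fix i assume "Suc 0 \<le> i" "i \<le> Suc CARD('n)"
      then have "p K i \<in> ?\<Omega>"
        using vK[of i] vK' K_sub[OF K] by auto
      then show "1 / (D (p K i))\<^sup>2 \<le> Linf_norm ?\<Omega> ?f"
        by (rule f_le)
    qed
    moreover have "\<bar>\<zeta> K\<bar> \<le> Max ((\<lambda>K. \<bar>\<zeta> K\<bar>) ` T)"
      using finT K by (intro Max_ge) auto
    moreover have
      "0 \<le> Max ((\<lambda>K. (min_containment_radius K)\<^sup>2) ` T) * Linf_norm2 ?\<Omega> ?f"
    proof (rule mult_nonneg_nonneg)
      show "0 \<le> Max ((\<lambda>K. (min_containment_radius K)\<^sup>2) ` T)"
        using finT K by (subst Max_ge_iff) auto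
      show "0 \<le> Linf_norm2 ?\<Omega> ?f"
        unfolding Linf_norm2_def by (rule Linf_norm_nonneg)
    qed
    ultimately show "1 / (diameter K)\<^sup>2 \<le>
        1/2 * Max ((\<lambda>K. (min_containment_radius K)\<^sup>2) ` T) * Linf_norm2 ?\<Omega> ?f +
        Linf_norm ?\<Omega> ?f + Max ((\<lambda>K. \<bar>\<zeta> K\<bar>) ` T)"
      by simp
    \<comment> \<open>\<open>K\<close> has at least two vertices, and these are separated by \<open>\<eta>\<close>.\<close>
    have N: "1 \<in> {1..?N}" "2 \<in> {1..?N}"
      by (auto simp: Suc_le_eq)
    then have "p K 1 \<noteq> p K 2"
      using assms(5)[OF K] unfolding bij_betw_def inj_on_def by (metis one_eq_numeral_iff num.distinct(1))
    then have "\<eta> \<le> dist (p K 1) (p K 2)"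
      using net N vK vert[OF K] unfolding eps_eta_net_def dist_norm by blast
    also have "\<dots> \<le> diameter K"
      using facts(1)[OF K] N vK vK' by (intro diameter_bounded_bound compact_imp_bounded) auto
    finally show "1 / (diameter K)\<^sup>2 \<le> 1 / \<eta>\<^sup>2"
      using net unfolding eps_eta_net_def
      by (intro divide_left_mono power_mono mult_pos_pos) auto
  qed
  have m0: "0 \<le> ?m"
  proof -
    obtain K where "K \<in> T" using False by blast
    then show ?thesis using diam[of K] by (meson order_trans zero_le_divide_1_iff zero_le_power2)
  qed

  let ?I = "\<lambda>K. \<integral>x. (\<Sum>i = 1..?N. \<Sum>j\<in>{1..<i}. (\<bar>g x\<bar> \<bullet> \<bar>p K j - p K i\<bar>)\<^sup>2) \<partial>lebesgue_on K"
  let ?E = "\<lambda>K. \<Sum>i = 1..?N. \<Sum>j\<in>{1..<i}. ((p K j - p K i) \<bullet> (p K j - p K i)) * measure lebesgue K"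
  have "(\<Sum>K\<in>T. 1 / (diameter K)\<^sup>2 * ?I K) \<le> (\<Sum>K\<in>T. ?m * (((1 + ?\<Lambda>) * M)\<^sup>2 * ?E K))"
  proof (intro sum_mono mult_mono diam m0)
    fix K assume "K \<in> T"
    then show "?I K \<le> ((1 + ?\<Lambda>) * M)\<^sup>2 * ?E K"
      using facts(1) by (intro edge_energy_integral_le g_le lmeasurable_compact)
  qed (assumption | intro Bochner_Integration.integral_nonneg sum_nonneg zero_le_power2)+
  also have "\<dots> = ((1 + ?\<Lambda>) * M)\<^sup>2 * ?m * Theta T p"
    unfolding Theta_def sum_distrib_left[of _ ?E] by (simp only: mult_ac)
  finally have "Psi T p g \<le> sqrt (((1 + ?\<Lambda>) * M)\<^sup>2 * ?m * Theta T p)"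
    unfolding Psi_def by (rule real_sqrt_le_mono)
  also have "\<dots> = (1 + ?\<Lambda>) * C3 S T D \<zeta> \<eta> * sqrt (Theta T p) * M"
    using \<Lambda>0 M0 by (simp add: C3_def real_sqrt_mult mult_ac)
  finally show ?thesis
    by (simp only: g_def[abs_def] M_def)
qed

end
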